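(* Let $S$ be an idempotent semifield and let $V$ be a free $S$-module of finite rank $n$ with basis $e_1,\dots,e_n$. If $w\in\bigwedge^dV$ and $w'\in\bigwedge^{d'}V$ are tropical Plücker vectors with nonzero wedge product, then $w\wedge w'\in\bigwedge^{d+d'}V$ is also a tropical Plücker vector.
   Context: An idempotent semifield $S$ is a (commutative) semiring satisfying all axioms of a field except the existence of additive inverses, and such that $s+s=s$ for all $s\in S$; its additive and multiplicative identities are $0$ and $1$. No total order is assumed. Write $[n]=\{1,\dots,n\}$, $I+j=I\cup\{j\}$, $I-j=I\smallsetminus\{j\}$. The tropical Grassmann algebra of $V$ is $\bigwedge V:=\mathrm{Sym}\,V/\langle e_i^2\sim 0\rangle_{i=1}^n$ (quotient by the generated $S$-algebra congruence), graded by $\bigwedge V=\bigoplus_{d\ge0}\bigwedge^dV$, with commutative product $\wedge$; $\bigwedge^dV$ is free with basis $e_I=e_{i_1}\wedge\cdots\wedge e_{i_d}$, $I\in\binom{[n]}{d}$. A nonzero $w=\sum_I w_Ie_I\in\bigwedge^dV$ is a (rank $d$) tropical Plücker vector if for all $A\in\binom{[n]}{d+1}$, $B\in\binom{[n]}{d-1}$ and every $p\in A\smallsetminus B$, $\sum_{i\in A\smallsetminus B}w_{A-i}w_{B+i}=\sum_{i\in A\smallsetminus B,\, i\ne p}w_{A-i}w_{B+i}$. *)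

theory Defs
  imports "HOL-Library.Poly_Mapping"
begin

class idempotent_semifield = comm_semiring_1 +
  assumes add_self: "a + a = a"
    and ex_mult_inverse: "a \<noteq> 0 \<Longrightarrow> \<exists>b. a * b = 1"

(* V is the free module on e_1, ..., e_n, so Sym V is the polynomial semiring S[e_1, ..., e_n].
   A polynomial maps each exponent vector to its coefficient. *)

type_synonym 's polynomial = "(nat \<Rightarrow>\<^sub>0 nat) \<Rightarrow>\<^sub>0 's"

definition Sym :: "nat \<Rightarrow> 's::comm_semiring_1 polynomial set" where
  "Sym n = {p. \<forall>m \<in> Poly_Mapping.keys p. Poly_Mapping.keys m \<subseteq> {1..n}}"

definition Const :: "'s::comm_semiring_1 \<Rightarrow> 's polynomial" where
  "Const c = Poly_Mapping.single 0 c"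

definition Var :: "nat \<Rightarrow> 's::comm_semiring_1 polynomial" where
  "Var i = Poly_Mapping.single (Poly_Mapping.single i 1) 1"

definition homogeneous :: "nat \<Rightarrow> 's::comm_semiring_1 polynomial \<Rightarrow> bool" where
  "homogeneous d p \<longleftrightarrow>
     (\<forall>m \<in> Poly_Mapping.keys p. (\<Sum>i \<in> Poly_Mapping.keys m. Poly_Mapping.lookup m i) = d)"

(* The congruence generated by e_i^2 ~ 0. Compatibility with scalars is the case r = Const c
   of compatibility with products. *)

inductive grassmann_cong :: "nat \<Rightarrow> 's::comm_semiring_1 polynomial \<Rightarrow> 's polynomial \<Rightarrow> bool"
  for n where
  square: "i \<in> {1..n} \<Longrightarrow> grassmann_cong n (Var i ^ 2) 0"
| refl: "p \<in> Sym n \<Longrightarrow> grassmann_cong n p p"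
| sym: "grassmann_cong n p q \<Longrightarrow> grassmann_cong n q p"
| trans: "grassmann_cong n p q \<Longrightarrow> grassmann_cong n q r \<Longrightarrow> grassmann_cong n p r"
| add: "grassmann_cong n p q \<Longrightarrow> grassmann_cong n r s \<Longrightarrow> grassmann_cong n (p + r) (q + s)"
| mult: "grassmann_cong n p q \<Longrightarrow> grassmann_cong n r s \<Longrightarrow> grassmann_cong n (p * r) (q * s)"

definition grassmann_rel :: "nat \<Rightarrow> ('s::comm_semiring_1 polynomial \<times> 's polynomial) set" where
  "grassmann_rel n = {(p, q). grassmann_cong n p q}"

definition grassmann_algebra :: "nat \<Rightarrow> 's::comm_semiring_1 polynomial set set" where
  "grassmann_algebra n = Sym n // grassmann_rel n"

definition grassmann_class :: "nat \<Rightarrow> 's::comm_semiring_1 polynomial \<Rightarrow> 's polynomial set" where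
  "grassmann_class n p = grassmann_rel n `` {p}"

definition wedge ::
    "nat \<Rightarrow> 's::comm_semiring_1 polynomial set \<Rightarrow> 's polynomial set \<Rightarrow> 's polynomial set" where
  "wedge n w w' = (\<Union>p \<in> w. \<Union>q \<in> w'. grassmann_class n (p * q))"

definition exterior_power :: "nat \<Rightarrow> nat \<Rightarrow> 's::comm_semiring_1 polynomial set set" where
  "exterior_power n d = grassmann_class n ` {p \<in> Sym n. homogeneous d p}"

definition subsets_of_size :: "nat \<Rightarrow> nat \<Rightarrow> nat set set" where
  "subsets_of_size n d = {I. I \<subseteq> {1..n} \<and> card I = d}"

definition basis_expansion ::
    "nat \<Rightarrow> nat \<Rightarrow> (nat set \<Rightarrow> 's::comm_semiring_1) \<Rightarrow> 's polynomial set" where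
  "basis_expansion n d c =
     grassmann_class n (\<Sum>I \<in> subsets_of_size n d. Const (c I) * (\<Prod>i \<in> I. Var i))"

(* The size of B is given as card B + 1 = d, so that there is no such B when d = 0.
   The coefficients c are determined by w, see basis_expansion_unique below. *)

definition tropical_pluecker_vector ::
    "nat \<Rightarrow> nat \<Rightarrow> 's::comm_semiring_1 polynomial set \<Rightarrow> bool" where
  "tropical_pluecker_vector n d w \<longleftrightarrow>
     w \<in> exterior_power n d \<and> w \<noteq> grassmann_class n 0 \<and>
     (\<exists>c. w = basis_expansion n d c \<and>
       (\<forall>A B. A \<subseteq> {1..n} \<and> card A = d + 1 \<and> B \<subseteq> {1..n} \<and> card B + 1 = d \<longrightarrow>
         (\<forall>p \<in> A - B.
            (\<Sum>i \<in> A - B. c (A - {i}) * c (insert i B)) =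
            (\<Sum>i \<in> A - B - {p}. c (A - {i}) * c (insert i B)))))"

lemma Sym_0 [simp]: "0 \<in> Sym n"
  by (simp add: Sym_def)

lemma Sym_add: "p \<in> Sym n \<Longrightarrow> q \<in> Sym n \<Longrightarrow> p + q \<in> Sym n"
  unfolding Sym_def using keys_add[of p q] by blast

lemma Sym_mult: "p \<in> Sym n \<Longrightarrow> q \<in> Sym n \<Longrightarrow> p * q \<in> Sym n"
proof -
  assume p: "p \<in> Sym n" and q: "q \<in> Sym n"
  have "Poly_Mapping.keys m \<subseteq> {1..n}" if "m \<in> Poly_Mapping.keys (p * q)" for m
  proof -
    obtain a b where "m = a + b" "a \<in> Poly_Mapping.keys p" "b \<in> Poly_Mapping.keys q"
      using keys_mult[of p q] \<open>m \<in> Poly_Mapping.keys (p * q)\<close> by blast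
    then show ?thesis
      using p q keys_add[of a b] unfolding Sym_def by blast
  qed
  then show ?thesis by (simp add: Sym_def)
qed

lemma Sym_single: "Poly_Mapping.keys m \<subseteq> {1..n} \<Longrightarrow> Poly_Mapping.single m c \<in> Sym n"
  by (simp add: Sym_def)

lemma Sym_sum: "(\<And>x. x \<in> X \<Longrightarrow> f x \<in> Sym n) \<Longrightarrow> sum f X \<in> Sym n"
  by (induction X rule: infinite_finite_induct) (auto intro: Sym_add)

lemma Var_power2: "(Var i :: 's::comm_semiring_1 polynomial) ^ 2
    = Poly_Mapping.single (Poly_Mapping.single i 2) 1"
  by (simp add: Var_def power2_eq_square mult_single numeral_2_eq_2 flip: single_add)

lemma grassmann_cong_Sym: "grassmann_cong n p q \<Longrightarrow> p \<in> Sym n \<and> q \<in> Sym n"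
  by (induction rule: grassmann_cong.induct)
     (auto simp: Var_power2 intro: Sym_add Sym_mult Sym_single)

lemma equiv_grassmann_rel: "equiv (Sym n) (grassmann_rel n)"
proof (rule equivI)
  show "grassmann_rel n \<subseteq> Sym n \<times> Sym n"
    using grassmann_cong_Sym by (auto simp: grassmann_rel_def)
  show "refl_on (Sym n) (grassmann_rel n)"
    using grassmann_cong.refl by (auto simp: grassmann_rel_def refl_on_def)
  show "Relation.sym (grassmann_rel n)"
    using grassmann_cong.sym by (auto simp: grassmann_rel_def sym_def)
  show "Relation.trans (grassmann_rel n)"
    unfolding grassmann_rel_def trans_def using grassmann_cong.trans by blast
qed

lemma grassmann_class_eq_iff:
  assumes "p \<in> Sym n" "q \<in> Sym n"
  shows "grassmann_class n p = grassmann_class n q \<longleftrightarrow> grassmann_cong n p q"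
  using eq_equiv_class_iff[OF equiv_grassmann_rel assms]
  by (simp add: grassmann_class_def grassmann_rel_def)

lemma exterior_power_subset: "exterior_power n d \<subseteq> grassmann_algebra n"
  by (auto simp: exterior_power_def grassmann_algebra_def grassmann_class_def intro: quotientI)

lemma wedge_grassmann_class:
  assumes "p \<in> Sym n" "q \<in> Sym n"
  shows "wedge n (grassmann_class n p) (grassmann_class n q) = grassmann_class n (p * q)"
proof -
  have "grassmann_class n (p' * q') = grassmann_class n (p * q)"
    if "p' \<in> grassmann_class n p" "q' \<in> grassmann_class n q" for p' q'
  proof -
    have pq: "grassmann_cong n p p'" "grassmann_cong n q q'"
      using that by (auto simp: grassmann_class_def grassmann_rel_def)
    then have "grassmann_cong n (p * q) (p' * q')" by (rule grassmann_cong.mult)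
    then show ?thesis
      using grassmann_cong_Sym grassmann_class_eq_iff by metis
  qed
  moreover have "p \<in> grassmann_class n p" "q \<in> grassmann_class n q"
    using assms by (auto simp: grassmann_class_def grassmann_rel_def intro: grassmann_cong.refl)
  ultimately show ?thesis unfolding wedge_def by blast
qed

definition squarefree_exponent :: "nat set \<Rightarrow> nat \<Rightarrow>\<^sub>0 nat" where
  "squarefree_exponent I = (\<Sum>i \<in> I. Poly_Mapping.single i 1)"

lemma lookup_squarefree_exponent:
  "finite I \<Longrightarrow> Poly_Mapping.lookup (squarefree_exponent I) i = (if i \<in> I then 1 else 0)"
  by (simp add: squarefree_exponent_def lookup_sum lookup_single when_def sum.delta)

lemma keys_squarefree_exponent: "finite I \<Longrightarrow> Poly_Mapping.keys (squarefree_exponent I) = I"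
  by (auto simp: in_keys_iff lookup_squarefree_exponent split: if_splits)

lemma basis_monomial:
  "Const c * (\<Prod>i \<in> I. Var i) = Poly_Mapping.single (squarefree_exponent I) c"
proof -
  have "(\<Prod>i \<in> I. Var i :: 'a polynomial) = Poly_Mapping.single (squarefree_exponent I) 1"
    by (induction I rule: infinite_finite_induct)
       (auto simp: squarefree_exponent_def Var_def mult_single)
  then show ?thesis by (simp add: Const_def mult_single)
qed

lemma finite_subsets_of_size [simp]: "finite (subsets_of_size n d)"
  by (rule finite_subset[of _ "Pow {1..n}"]) (auto simp: subsets_of_size_def)

lemma finite_in_subsets_of_size: "I \<in> subsets_of_size n d \<Longrightarrow> finite I"
  using finite_subset[of I "{1..n}"] by (simp add: subsets_of_size_def)

lemma basis_sum_Sym: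
  "(\<Sum>I \<in> subsets_of_size n d. Const (c I) * (\<Prod>i \<in> I. Var i)) \<in> Sym n"
proof (unfold basis_monomial, intro Sym_sum Sym_single)
  fix I assume I: "I \<in> subsets_of_size n d"
  then show "Poly_Mapping.keys (squarefree_exponent I) \<subseteq> {1..n}"
    unfolding keys_squarefree_exponent[OF finite_in_subsets_of_size[OF I]]
    by (simp add: subsets_of_size_def)
qed

lemma squarefree_exponent_eq_iff:
  "finite I \<Longrightarrow> finite J \<Longrightarrow> squarefree_exponent I = squarefree_exponent J \<longleftrightarrow> I = J"
  by (metis keys_squarefree_exponent)

lemma lookup_basis_sum:
  assumes "J \<in> subsets_of_size n d"
  shows "Poly_Mapping.lookup (\<Sum>I \<in> subsets_of_size n d. Const (c I) * (\<Prod>i \<in> I. Var i))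
           (squarefree_exponent J) = c J"
proof -
  have "Poly_Mapping.lookup (\<Sum>I \<in> subsets_of_size n d. Const (c I) * (\<Prod>i \<in> I. Var i))
          (squarefree_exponent J)
      = (\<Sum>I \<in> subsets_of_size n d. if I = J then c I else 0)"
    unfolding basis_monomial lookup_sum
    by (rule sum.cong)
       (use assms in \<open>auto simp: lookup_single when_def squarefree_exponent_eq_iff
          finite_in_subsets_of_size\<close>)
  then show ?thesis using assms by (simp add: sum.delta)
qed

lemma grassmann_cong_lookup:
  assumes "grassmann_cong n p q" "\<forall>i. Poly_Mapping.lookup m i \<le> 1"
  shows "Poly_Mapping.lookup p m = Poly_Mapping.lookup q m"
  using assms
proof (induction arbitrary: m rule: grassmann_cong.induct)
  case (square i)
  have "Poly_Mapping.single i 2 \<noteq> m"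
    using square.prems by (metis lookup_single_eq numeral_le_one_iff semiring_norm(69))
  then show ?case by (simp add: Var_power2 lookup_single_not_eq)
next
  case (add p q r s)
  then show ?case by (simp add: lookup_add)
next
  case (mult p q r s)
  have "Poly_Mapping.lookup p l * (\<Sum>k. Poly_Mapping.lookup r k when m = l + k)
      = Poly_Mapping.lookup q l * (\<Sum>k. Poly_Mapping.lookup s k when m = l + k)" for l
  proof (cases "\<exists>k. m = l + k")
    case True
    have le: "\<forall>i. Poly_Mapping.lookup l i \<le> 1" "\<forall>i. Poly_Mapping.lookup k i \<le> 1" if "m = l + k" for k
      using mult.prems unfolding that lookup_add by (metis add_leD1, metis add_leD2)
    then have "Poly_Mapping.lookup p l = Poly_Mapping.lookup q l" using True mult.IH(1) by blast
    moreover have "(Poly_Mapping.lookup r k when m = l + k) = (Poly_Mapping.lookup s k when m = l + k)" for k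
      using le(2) mult.IH(2) by (auto simp: when_def)
    ultimately show ?thesis by simp
  qed (simp add: when_def)
  then show ?case by (simp add: lookup_mult)
qed auto

lemma basis_expansion_unique:
  fixes c c' :: "nat set \<Rightarrow> 'a::comm_semiring_1"
  assumes "basis_expansion n d c = basis_expansion n d c'" "I \<in> subsets_of_size n d"
  shows "c I = c' I"
proof -
  define f where "f c = (\<Sum>I \<in> subsets_of_size n d. Const (c I) * (\<Prod>i \<in> I. Var i))"
    for c :: "nat set \<Rightarrow> 'a"
  have "grassmann_cong n (f c) (f c')"
    using assms(1) unfolding basis_expansion_def f_def
    by (rule iffD1[OF grassmann_class_eq_iff[OF basis_sum_Sym basis_sum_Sym]])
  moreover have "\<forall>i. Poly_Mapping.lookup (squarefree_exponent I) i \<le> 1"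
    using assms(2) by (simp add: finite_in_subsets_of_size lookup_squarefree_exponent)
  ultimately have "Poly_Mapping.lookup (f c) (squarefree_exponent I)
      = Poly_Mapping.lookup (f c') (squarefree_exponent I)"
    by (rule grassmann_cong_lookup)
  then show ?thesis by (simp add: f_def lookup_basis_sum[OF assms(2)])
qed

lemma grassmann_cong_nonsquarefree:
  fixes c :: "'s::comm_semiring_1"
  assumes "Poly_Mapping.keys m \<subseteq> {1..n}" "Poly_Mapping.lookup m i > 1"
  shows "grassmann_cong n (Poly_Mapping.single m c) 0"
proof -
  define m' where "m' = m - Poly_Mapping.single i 2"
  have m: "m = m' + Poly_Mapping.single i 2"
    using assms(2) by (intro poly_mapping_eqI)
      (auto simp: m'_def lookup_add lookup_minus lookup_single when_def)
  have "Poly_Mapping.keys m' \<subseteq> Poly_Mapping.keys m"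
    by (auto simp: m'_def in_keys_iff lookup_minus)
  then have "grassmann_cong n (Poly_Mapping.single m' c) (Poly_Mapping.single m' c)"
    using assms by (intro grassmann_cong.refl Sym_single) auto
  moreover have "i \<in> {1..n}"
    using assms in_keys_iff[of i m] by auto
  ultimately have "grassmann_cong n (Poly_Mapping.single m' c * Var i ^ 2)
      (Poly_Mapping.single m' c * 0)"
    by (intro grassmann_cong.mult grassmann_cong.square)
  then show ?thesis by (simp add: Var_power2 mult_single flip: m)
qed

lemma grassmann_cong_sum:
  "(\<And>x. x \<in> X \<Longrightarrow> grassmann_cong n (f x) (g x)) \<Longrightarrow> grassmann_cong n (sum f X) (sum g X)"
  by (induction X rule: infinite_finite_induct)
     (auto intro: grassmann_cong.add grassmann_cong.refl)

lemma exterior_power_eq: "exterior_power n d = range (basis_expansion n d)"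
proof (rule antisym; rule subsetI)
  fix w :: "'a polynomial set"
  assume "w \<in> exterior_power n d"
  then obtain p where p: "p \<in> Sym n" "homogeneous d p" and w: "w = grassmann_class n p"
    by (auto simp: exterior_power_def)
  define K where "K = {m \<in> Poly_Mapping.keys p. \<forall>i. Poly_Mapping.lookup m i \<le> 1}"
  define c where "c I = Poly_Mapping.lookup p (squarefree_exponent I)" for I
  have p_sum: "p = (\<Sum>m \<in> Poly_Mapping.keys p. Poly_Mapping.single m (Poly_Mapping.lookup p m))"
    by (rule poly_mapping_eqI) (auto simp: lookup_sum lookup_single when_def in_keys_iff sum.delta)
  have "grassmann_cong n (\<Sum>m \<in> Poly_Mapping.keys p. Poly_Mapping.single m (Poly_Mapping.lookup p m))
      (\<Sum>m \<in> Poly_Mapping.keys p. if m \<in> K then Poly_Mapping.single m (Poly_Mapping.lookup p m) else 0)"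
  proof (rule grassmann_cong_sum)
    fix m assume m: "m \<in> Poly_Mapping.keys p"
    then have "Poly_Mapping.keys m \<subseteq> {1..n}" using p by (auto simp: Sym_def)
    then show "grassmann_cong n (Poly_Mapping.single m (Poly_Mapping.lookup p m))
        (if m \<in> K then Poly_Mapping.single m (Poly_Mapping.lookup p m) else 0)"
      using m grassmann_cong_nonsquarefree[of m n]
        grassmann_cong.refl[OF Sym_single[of m n]]
      by (auto simp: K_def not_le)
  qed
  moreover have "(\<Sum>m \<in> Poly_Mapping.keys p. if m \<in> K then Poly_Mapping.single m (Poly_Mapping.lookup p m) else 0)
      = (\<Sum>m \<in> K. Poly_Mapping.single m (Poly_Mapping.lookup p m))"
    by (rule sum.mono_neutral_cong_right) (auto simp: K_def)
  moreover have "\<dots> = (\<Sum>m \<in> squarefree_exponent ` subsets_of_size n d.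
      Poly_Mapping.single m (Poly_Mapping.lookup p m))"
  proof (rule sum.mono_neutral_left)
    show "K \<subseteq> squarefree_exponent ` subsets_of_size n d"
    proof
      fix m assume m: "m \<in> K"
      have one: "Poly_Mapping.lookup m i = 1" if "i \<in> Poly_Mapping.keys m" for i
      proof -
        have "Poly_Mapping.lookup m i \<le> 1" using m by (simp add: K_def)
        moreover have "Poly_Mapping.lookup m i \<noteq> 0" using that by (simp add: in_keys_iff)
        ultimately show ?thesis by linarith
      qed
      then have "m = squarefree_exponent (Poly_Mapping.keys m)"
        by (intro poly_mapping_eqI) (auto simp: lookup_squarefree_exponent in_keys_iff)
      moreover have "(\<Sum>i \<in> Poly_Mapping.keys m. Poly_Mapping.lookup m i) = card (Poly_Mapping.keys m)" using one by simp
      then have "Poly_Mapping.keys m \<in> subsets_of_size n d"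
        using m p unfolding K_def Sym_def homogeneous_def subsets_of_size_def by auto
      ultimately show "m \<in> squarefree_exponent ` subsets_of_size n d" by blast
    qed
    show "\<forall>m \<in> squarefree_exponent ` subsets_of_size n d - K.
        Poly_Mapping.single m (Poly_Mapping.lookup p m) = 0"
      by (auto simp: K_def in_keys_iff lookup_squarefree_exponent finite_in_subsets_of_size)
  qed simp
  moreover have "\<dots> = (\<Sum>I \<in> subsets_of_size n d. Const (c I) * (\<Prod>i \<in> I. Var i))"
    unfolding basis_monomial c_def
    by (subst sum.reindex)
       (auto simp: inj_on_def squarefree_exponent_eq_iff finite_in_subsets_of_size)
  ultimately have "grassmann_cong n p
      (\<Sum>I \<in> subsets_of_size n d. Const (c I) * (\<Prod>i \<in> I. Var i))"
    by (simp only: p_sum[symmetric])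
  then have "w = basis_expansion n d c"
    using grassmann_class_eq_iff[OF p(1) basis_sum_Sym] by (simp add: w basis_expansion_def)
  then show "w \<in> range (basis_expansion n d)" by blast
next
  fix w :: "'a polynomial set"
  assume "w \<in> range (basis_expansion n d)"
  then obtain c where w: "w = basis_expansion n d c" by blast
  have "homogeneous d (\<Sum>I \<in> subsets_of_size n d. Const (c I) * (\<Prod>i \<in> I. Var i))"
    unfolding homogeneous_def
  proof
    fix m
    assume "m \<in> Poly_Mapping.keys (\<Sum>I \<in> subsets_of_size n d. Const (c I) * (\<Prod>i \<in> I. Var i))"
    then have "(\<Sum>I \<in> subsets_of_size n d.
        Poly_Mapping.lookup (Poly_Mapping.single (squarefree_exponent I) (c I)) m) \<noteq> 0"
      unfolding basis_monomial in_keys_iff lookup_sum .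
    then obtain I where I: "I \<in> subsets_of_size n d" "m = squarefree_exponent I"
      by (metis (mono_tags, lifting) lookup_single_not_eq sum.neutral)
    then have "finite I" by (simp add: finite_in_subsets_of_size)
    then show "(\<Sum>i \<in> Poly_Mapping.keys m. Poly_Mapping.lookup m i) = d"
      using I by (simp add: keys_squarefree_exponent lookup_squarefree_exponent subsets_of_size_def)
  qed
  then show "w \<in> exterior_power n d"
    using basis_sum_Sym unfolding w basis_expansion_def exterior_power_def by blast
qed

end

theory Submission
  imports Defs
begin

text \<open>
  Order an idempotent semifield by \<open>a \<preceq> b \<longleftrightarrow> a + b = b\<close>. The tropical Pluecker relation for
  \<open>A\<close>, \<open>B\<close> and \<open>p\<close> then says that the \<open>p\<close>-th term \<open>w\<^bsub>A-p\<^esub> w\<^bsub>B+p\<^esub>\<close> is bounded by the sum of the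
  other terms.

  The coefficients of a wedge product are \<open>u\<^bsub>K\<^esub> = (\<Sum>J \<subseteq> K. w\<^bsub>K-J\<^esub> w'\<^bsub>J\<^esub>)\<close>
  (\<open>wedge_basis_expansion\<close>). Expanding \<open>u\<^bsub>A-p\<^esub> u\<^bsub>B+p\<^esub>\<close> and exchanging elements alternately with
  the relations of \<open>w\<close> and of \<open>w'\<close> does not prove the relations for \<open>u\<close>: such a chain of
  exchanges may run into a cycle. Instead, \<open>u\<close> is built in steps which each involve only one
  possible cycle. Place \<open>w\<close> and \<open>w'\<close> on disjoint copies of the ground set; their direct sum, the
  function \<open>I \<squnion> J \<mapsto> w\<^bsub>I\<^esub> w'\<^bsub>J\<^esub>\<close>, clearly satisfies the relations
  (\<open>pluecker_relations_direct_sum\<close>). Then identify the two copies of each element, one element at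
  a time (\<open>pluecker_relations_partial_wedge\<close>); the result is \<open>u\<close>.

  The heart is that one identification \<open>b \<mapsto> a\<close> preserves the relations
  (\<open>pluecker_relations_identify\<close>). Let \<open>T\<close> be the sum of the terms other than the \<open>p\<close>-th of the new
  relation. When \<open>a\<close> is in both \<open>A\<close> and \<open>B\<close>, write \<open>A'\<close>, \<open>B'\<close> for \<open>A - a + b\<close>, \<open>B - a + b\<close>. The
  \<open>p\<close>-th term is the sum of four products, of the pairs \<open>(A, B)\<close>, \<open>(A', B')\<close>, \<open>(A, B')\<close> and
  \<open>(A', B)\<close>. The old relations bound the first two, say \<open>s\<close> and \<open>t\<close>, by \<open>T\<close>. For the last two,
  say \<open>x\<close> and \<open>y\<close>, the old relations contain one further term, which is the same for both;
  eliminating it gives only the circular bounds \<open>x \<preceq> y + T\<close> and \<open>y \<preceq> x + T\<close>. But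
  \<open>x * y = s * t \<preceq> T * T\<close>, so \<open>x\<close> and \<open>y\<close> cannot both exceed \<open>T\<close>. Without a total order, this last
  step is the cancellation argument of \<open>nle_of_mutual_bounds\<close>.
\<close>

section \<open>The natural order of an idempotent semifield\<close>

definition nle :: "'s::idempotent_semifield \<Rightarrow> 's \<Rightarrow> bool"  (infix \<open>\<preceq>\<close> 50) where
  "a \<preceq> b \<longleftrightarrow> a + b = b"

lemma nle_refl [simp]: "a \<preceq> a"
  by (simp add: nle_def add_self)

lemma nle_antisym: "a \<preceq> b \<Longrightarrow> b \<preceq> a \<Longrightarrow> a = b"
  by (metis nle_def add.commute)

lemma nle_trans [trans]: "a \<preceq> b \<Longrightarrow> b \<preceq> c \<Longrightarrow> a \<preceq> c"
  unfolding nle_def by (metis add.assoc)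

lemma nle_zero [simp]: "0 \<preceq> a"
  by (simp add: nle_def)

lemma add_nle_iff: "a + b \<preceq> c \<longleftrightarrow> a \<preceq> c \<and> b \<preceq> c"
  unfolding nle_def by (metis add.assoc add.commute add_self)

lemma nle_add_left: "a \<preceq> b \<Longrightarrow> a \<preceq> b + c"
  unfolding nle_def by (metis add.assoc)

lemma nle_add_right: "a \<preceq> c \<Longrightarrow> a \<preceq> b + c"
  unfolding nle_def by (metis add.left_commute)

lemma mult_nle_left: "a \<preceq> b \<Longrightarrow> c * a \<preceq> c * b"
  unfolding nle_def by (metis distrib_left)

lemma mult_nle: "a \<preceq> b \<Longrightarrow> c \<preceq> d \<Longrightarrow> a * c \<preceq> b * d"
  by (metis mult.commute mult_nle_left nle_trans)

lemma mult_nle_cancel_right: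
  assumes "a * c \<preceq> b * c" "c \<noteq> 0"
  shows "a \<preceq> b"
proof -
  obtain d where d: "c * d = 1"
    using ex_mult_inverse[OF assms(2)] by blast
  have "a * c * d \<preceq> b * c * d"
    using mult_nle[OF assms(1) nle_refl] .
  then show ?thesis
    using d by (simp add: mult.assoc)
qed

text \<open>
  If the order is total, one of \<open>x\<close> and \<open>y\<close> is at most \<open>t\<close> by the bound on the product, and then
  so is the other. In general put \<open>m = x + t = y + t\<close>; expanding \<open>m * m = (x + t) * (y + t)\<close>
  shows \<open>m * m \<preceq> t * m\<close>, and \<open>m\<close> can be cancelled.
\<close>

lemma nle_of_mutual_bounds:
  assumes "x \<preceq> y + t" "y \<preceq> x + t" "x * y \<preceq> t * t"
  shows "x \<preceq> t"
proof (cases "x + t = 0")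
  case True
  then show ?thesis
    by (metis nle_add_left nle_refl nle_zero nle_antisym)
next
  case False
  define m where "m = x + t"
  have m: "m = y + t"
    unfolding m_def using assms
    by (intro nle_antisym) (auto simp: add_nle_iff intro: nle_add_right)
  have "m * m = x * y + t * x + (t * y + t * t)"
    by (subst (2) m) (simp add: m_def algebra_simps)
  also have "\<dots> \<preceq> t * m"
  proof -
    have "x \<preceq> m" "y \<preceq> m" "t \<preceq> m"
      using assms(2) by (auto simp: m_def intro: nle_add_left nle_add_right)
    moreover have "x * y \<preceq> t * m"
      using assms(3) nle_trans mult_nle_left[OF \<open>t \<preceq> m\<close>] by blast
    ultimately show ?thesis
      by (simp add: add_nle_iff mult_nle_left)
  qed
  finally have "m \<preceq> t"
    using mult_nle_cancel_right False m_def by blast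
  then show ?thesis
    by (simp add: m_def add_nle_iff)
qed

lemma sum_nle_sum:
  "(\<And>i. i \<in> X \<Longrightarrow> f i \<preceq> g i) \<Longrightarrow> sum f X \<preceq> sum g X"
  by (induction X rule: infinite_finite_induct)
    (auto simp: add_nle_iff intro: nle_add_left nle_add_right)

section \<open>Set functions satisfying the tropical Pluecker relations\<close>

text \<open>
  There is no ground set and no rank here: a function on \<open>d\<close>-subsets of a ground set is extended by
  zero, and a relation for sets \<open>A\<close> and \<open>B\<close> that do not fit the ground set or the rank then has only
  zero terms. Hence functions on different ground sets and of different ranks can be combined without
  side conditions.
\<close>

definition pluecker_relations :: "('a set \<Rightarrow> 's::idempotent_semifield) \<Rightarrow> bool" where
  "pluecker_relations P \<longleftrightarrow> (\<forall>A B p. finite A \<longrightarrow> finite B \<longrightarrow> p \<in> A - B \<longrightarrow>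
     P (A - {p}) * P (insert p B) \<preceq> (\<Sum>i \<in> A - B - {p}. P (A - {i}) * P (insert i B)))"

lemma pluecker_relationsD:
  assumes "pluecker_relations P" "finite A" "finite B" "p \<in> A - B"
  shows "P (A - {p}) * P (insert p B) \<preceq> (\<Sum>i \<in> A - B - {p}. P (A - {i}) * P (insert i B))"
  using assms unfolding pluecker_relations_def by blast

lemma sum_eq_sum_remove_iff:
  assumes "finite X" "p \<in> X"
  shows "sum f X = sum f (X - {p}) \<longleftrightarrow> f p \<preceq> sum f (X - {p})"
  using sum.remove[OF assms, of f] by (simp add: nle_def)

section \<open>Direct sums\<close>

definition direct_sum ::
    "('a set \<Rightarrow> 's::idempotent_semifield) \<Rightarrow> ('b set \<Rightarrow> 's) \<Rightarrow> ('a + 'b) set \<Rightarrow> 's" where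
  "direct_sum P P' X = P (Inl -` X) * P' (Inr -` X)"

lemma sum_Inl_Inr:
  assumes "finite X"
  shows "sum f X = (\<Sum>i \<in> Inl -` X. f (Inl i)) + (\<Sum>i \<in> Inr -` X. f (Inr i))"
proof -
  have X: "X = (Inl -` X) <+> (Inr -` X)"
    by (auto simp: Plus_def image_iff) (metis old.sum.exhaust)
  have "finite (Inl -` X)" "finite (Inr -` X)"
    using assms by (auto intro: finite_vimageI)
  then show ?thesis
    by (subst X) (simp add: sum.Plus)
qed

lemma vimage_Inl_Inr_simps:
  "Inl -` (X - {Inl i}) = Inl -` X - {i}"
  "Inr -` (X - {Inr j}) = Inr -` X - {j}"
  "Inl -` (X - {Inr j}) = Inl -` X"
  "Inr -` (X - {Inl i}) = Inr -` X"
  "Inl -` insert (Inl i) X = insert i (Inl -` X)"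
  "Inr -` insert (Inr j) X = insert j (Inr -` X)"
  "Inl -` insert (Inr j) X = Inl -` X"
  "Inr -` insert (Inl i) X = Inr -` X"
  by auto

text \<open>
  The sum over \<open>A - B\<close> splits into the part in the left and the part in the right summand. If \<open>p\<close> is
  on the left, then the left part alone bounds the \<open>p\<close>-th term: it is a relation of \<open>P\<close> multiplied
  by a constant.
\<close>

lemma pluecker_relations_direct_sum:
  fixes P :: "'a set \<Rightarrow> 's::idempotent_semifield" and P' :: "'b set \<Rightarrow> 's"
  assumes "pluecker_relations P" "pluecker_relations P'"
  shows "pluecker_relations (direct_sum P P')"
  unfolding pluecker_relations_def
proof (intro allI impI)
  fix A B :: "('a + 'b) set" and p
  assume fin: "finite A" "finite B" and p: "p \<in> A - B"
  have fin': "finite (Inl -` A)" "finite (Inr -` A)" "finite (Inl -` B)" "finite (Inr -` B)"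
    using fin by (auto intro: finite_vimageI)
  let ?W = "direct_sum P P'"
  let ?A = "Inl -` A" let ?B = "Inl -` B" let ?A' = "Inr -` A" let ?B' = "Inr -` B"
  have split: "(\<Sum>i \<in> A - B - {p}. ?W (A - {i}) * ?W (insert i B))
     = (\<Sum>i \<in> Inl -` (A - B - {p}). P (?A - {i}) * P (insert i ?B) * (P' ?A' * P' ?B'))
     + (\<Sum>i \<in> Inr -` (A - B - {p}). P' (?A' - {i}) * P' (insert i ?B') * (P ?A * P ?B))"
    using fin by (simp add: sum_Inl_Inr direct_sum_def vimage_Inl_Inr_simps ac_simps)
  show "?W (A - {p}) * ?W (insert p B) \<preceq> (\<Sum>i \<in> A - B - {p}. ?W (A - {i}) * ?W (insert i B))"
  proof (cases p)
    case (Inl q)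
    then have q: "q \<in> ?A - ?B"
      using p by simp
    have "?W (A - {p}) * ?W (insert p B)
        = P (?A - {q}) * P (insert q ?B) * (P' ?A' * P' ?B')"
      by (simp add: Inl direct_sum_def vimage_Inl_Inr_simps ac_simps)
    also have "\<dots> \<preceq> (\<Sum>i \<in> ?A - ?B - {q}. P (?A - {i}) * P (insert i ?B)) * (P' ?A' * P' ?B')"
      using pluecker_relationsD[OF assms(1) fin'(1,3) q] by (intro mult_nle) auto
    also have "\<dots> \<preceq> (\<Sum>i \<in> A - B - {p}. ?W (A - {i}) * ?W (insert i B))"
      unfolding split by (intro nle_add_left)
        (simp add: Inl sum_distrib_right vimage_Diff vimage_Inl_Inr_simps)
    finally show ?thesis .
  next
    case (Inr q)
    then have q: "q \<in> ?A' - ?B'"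
      using p by simp
    have "?W (A - {p}) * ?W (insert p B)
        = P' (?A' - {q}) * P' (insert q ?B') * (P ?A * P ?B)"
      by (simp add: Inr direct_sum_def vimage_Inl_Inr_simps ac_simps)
    also have "\<dots> \<preceq> (\<Sum>i \<in> ?A' - ?B' - {q}. P' (?A' - {i}) * P' (insert i ?B')) * (P ?A * P ?B)"
      using pluecker_relationsD[OF assms(2) fin'(2,4) q] by (intro mult_nle) auto
    also have "\<dots> \<preceq> (\<Sum>i \<in> A - B - {p}. ?W (A - {i}) * ?W (insert i B))"
      unfolding split by (intro nle_add_right)
        (simp add: Inr sum_distrib_right vimage_Diff vimage_Inl_Inr_simps)
    finally show ?thesis .
  qed
qed

section \<open>Identifying two elements\<close>

text \<open>
  This is the pushforward of \<open>P\<close> under the linear map that sends \<open>e\<^sub>b\<close> to \<open>e\<^sub>a\<close> and fixes the other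
  basis vectors. A set with both \<open>a\<close> and \<open>b\<close> contributes nothing, as \<open>e\<^sub>a \<and> e\<^sub>a = 0\<close>. The element
  \<open>b\<close> leaves the ground set, which is why the value is zero on sets that contain \<open>b\<close>.
\<close>

definition identify :: "'a \<Rightarrow> 'a \<Rightarrow> ('a set \<Rightarrow> 's::idempotent_semifield) \<Rightarrow> 'a set \<Rightarrow> 's" where
  "identify a b P X =
     (if b \<in> X then 0 else if a \<in> X then P X + P (insert b (X - {a})) else P X)"

text \<open>
  Terms with \<open>b\<close> vanish, so let \<open>b\<close> be outside \<open>A\<close> and \<open>B\<close>. Unless \<open>a\<close> is in both sets, the new
  relation is a sum of old ones: those of \<open>(A, B)\<close> and \<open>(A', B)\<close> if \<open>a \<in> A\<close>, and those of \<open>(A, B)\<close>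
  and \<open>(A, B')\<close> if \<open>a \<in> B\<close>. If \<open>a\<close> is in both, the relations of \<open>(A, B')\<close> and \<open>(A', B)\<close> have the
  extra term \<open>z\<close>, and the argument by mutual bounds is needed.
\<close>

lemma pluecker_relations_identify:
  fixes P :: "'a set \<Rightarrow> 's::idempotent_semifield"
  assumes P: "pluecker_relations P" and ab: "a \<noteq> b"
  shows "pluecker_relations (identify a b P)"
  unfolding pluecker_relations_def
proof (intro allI impI)
  fix A B :: "'a set" and p :: 'a
  assume fin: "finite A" "finite B" and p: "p \<in> A - B"
  let ?Q = "identify a b P"
  define T where "T = (\<Sum>i \<in> A - B - {p}. ?Q (A - {i}) * ?Q (insert i B))"
  define A' where "A' = insert b (A - {a})"
  define B' where "B' = insert b (B - {a})"
  have fin': "finite A'" "finite B'"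
    using fin by (auto simp: A'_def B'_def)
  have T_ge: "(\<Sum>i \<in> A - B - {p}. f i) \<preceq> T"
    if "\<And>i. i \<in> A - B - {p} \<Longrightarrow> f i \<preceq> ?Q (A - {i}) * ?Q (insert i B)" for f
    unfolding T_def using that by (rule sum_nle_sum)
  have rel: "P (C - {q}) * P (insert q D) \<preceq> (\<Sum>i \<in> C - D - {q}. P (C - {i}) * P (insert i D))"
    if "finite C" "finite D" "q \<in> C - D" for C D q
    using pluecker_relationsD[OF P that] .
  have "?Q (A - {p}) * ?Q (insert p B) \<preceq> T"
  proof (cases "b \<in> A \<or> b \<in> B")
    case True
    then show ?thesis
      by (auto simp: identify_def)
  next
    case False
    then have b: "b \<notin> A" "b \<notin> B" by auto
    have Q_A: "?Q (A - {i}) = (if a \<in> A \<and> i \<noteq> a then P (A - {i}) + P (A' - {i}) else P (A - {i}))"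
      if "i \<in> A" for i
    proof -
      have "i \<noteq> b" using that b by auto
      then have "insert b (A - {i} - {a}) = A' - {i}"
        by (auto simp: A'_def)
      then show ?thesis using b by (auto simp: identify_def)
    qed
    have Q_B: "?Q (insert i B) = (if a \<in> B then P (insert i B) + P (insert i B')
        else if i = a then P (insert a B) + P (insert b B) else P (insert i B))"
      if "i \<in> A - B" for i
    proof -
      have ib: "i \<noteq> b" using that b by auto
      have "insert b (insert i B - {a}) = insert i B'" if "i \<noteq> a"
        using that by (auto simp: B'_def)
      moreover have "i \<noteq> a" if "a \<in> B" using that \<open>i \<in> A - B\<close> by auto
      moreover have "insert b (insert a B - {a}) = insert b B" if "a \<notin> B"
        using that by auto
      ultimately show ?thesis using b ib by (auto simp: identify_def)
    qed
    consider "a \<notin> A" "a \<notin> B" | "a \<in> A" "a \<notin> B" | "a \<notin> A" "a \<in> B" | "a \<in> A" "a \<in> B"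
      by blast
    then show ?thesis
    proof cases
      case 1
      then have "i \<noteq> a" if "i \<in> A" for i using that by auto
      then have "?Q (A - {p}) * ?Q (insert p B) = P (A - {p}) * P (insert p B)"
        using p 1 by (simp add: Q_A Q_B)
      also have "\<dots> \<preceq> T"
        using 1 by (intro nle_trans[OF rel[OF fin p] T_ge]) (auto simp: Q_A Q_B)
      finally show ?thesis .
    next
      case 2
      have A'B: "A' - B = insert b (A - B - {a})"
        using 2 b by (auto simp: A'_def)
      have A'b: "A' - {b} = A - {a}"
        using b by (auto simp: A'_def)
      have r1: "P (A - {p}) * P (insert p B) \<preceq> T"
        using 2 by (intro nle_trans[OF rel[OF fin p] T_ge])
          (auto simp: Q_A Q_B algebra_simps intro: nle_add_left nle_add_right)
      show ?thesis
      proof (cases "p = a")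
        case True
        have "P (A' - {b}) * P (insert b B) \<preceq> (\<Sum>i \<in> A - B - {a}. P (A' - {i}) * P (insert i B))"
          using rel[OF fin'(1) fin(2), of b] b by (simp add: A'B)
        also have "\<dots> \<preceq> T"
          unfolding True[symmetric] using 2 True
          by (intro T_ge) (auto simp: Q_A Q_B algebra_simps intro: nle_add_left nle_add_right)
        finally have "P (A - {a}) * P (insert b B) \<preceq> T"
          by (simp add: A'b)
        then show ?thesis
          using r1 p 2 True by (simp add: Q_A Q_B algebra_simps add_nle_iff)
      next
        case False
        \<comment> \<open>The summand \<open>b\<close> of the relation of \<open>(A', B)\<close> takes over the role of the summand \<open>a\<close>,
          as both lead to the same sets after the identification.\<close>
        define f where "f i = (if i = a then P (A - {a}) * P (insert b B)
            else P (A' - {i}) * P (insert i B))" for i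
        have pb: "insert b (A - B - {a}) - {p} = insert b (A - B - {p} - {a})"
          using p b by auto
        have "P (A' - {p}) * P (insert p B)
            \<preceq> (\<Sum>i \<in> insert b (A - B - {p} - {a}). P (A' - {i}) * P (insert i B))"
          using rel[OF fin'(1) fin(2), of p] p False by (simp add: A'B pb)
        also have "\<dots> = P (A - {a}) * P (insert b B) +
            (\<Sum>i \<in> A - B - {p} - {a}. P (A' - {i}) * P (insert i B))"
          using fin b by (simp add: A'b)
        also have "\<dots> = f a + (\<Sum>i \<in> A - B - {p} - {a}. f i)"
          by (simp add: f_def)
        also have "\<dots> = (\<Sum>i \<in> A - B - {p}. f i)"
          using fin 2 False by (intro sum.remove[symmetric]) auto
        also have "\<dots> \<preceq> T"
          unfolding f_def using 2 by (intro T_ge)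
            (auto simp: Q_A Q_B algebra_simps intro: nle_add_left nle_add_right)
        finally show ?thesis
          using r1 p 2 False by (simp add: Q_A Q_B algebra_simps add_nle_iff)
      qed
    next
      case 3
      have AB: "A - B' = A - B"
        using b 3 by (auto simp: B'_def)
      have "P (A - {p}) * P (insert p B) \<preceq> T"
        using 3 by (intro nle_trans[OF rel[OF fin p] T_ge])
          (auto simp: Q_A Q_B algebra_simps intro: nle_add_left nle_add_right)
      moreover have "P (A - {p}) * P (insert p B') \<preceq> (\<Sum>i \<in> A - B - {p}. P (A - {i}) * P (insert i B'))"
        using rel[OF fin(1) fin'(2), of p] p by (simp add: AB)
      then have "P (A - {p}) * P (insert p B') \<preceq> T"
        using 3 by (rule_tac nle_trans[OF _ T_ge])
          (auto simp: Q_A Q_B algebra_simps intro: nle_add_left nle_add_right)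
      ultimately show ?thesis
        using p 3 by (simp add: Q_A Q_B algebra_simps add_nle_iff)
    next
      case 4
      then have ne: "i \<noteq> a" "i \<noteq> b" if "i \<in> A - B" for i using that b by auto
      have QQ: "?Q (A - {i}) * ?Q (insert i B)
          = (P (A - {i}) + P (A' - {i})) * (P (insert i B) + P (insert i B'))"
        if "i \<in> A - B" for i
        using that ne[OF that] 4 by (simp add: Q_A Q_B)
      have term_le: "P (C - {i}) * P (insert i D) \<preceq> ?Q (A - {i}) * ?Q (insert i B)"
        if "i \<in> A - B" "C \<in> {A, A'}" "D \<in> {B, B'}" for C D i
        unfolding QQ[OF that(1)] using that(2,3)
        by (intro mult_nle) (auto intro: nle_add_left nle_add_right)
      have sum_le: "(\<Sum>i \<in> A - B - {p}. P (C - {i}) * P (insert i D)) \<preceq> T"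
        if "C \<in> {A, A'}" "D \<in> {B, B'}" for C D
        using term_le that by (intro T_ge) auto
      define x where "x = P (A - {p}) * P (insert p B')"
      define y where "y = P (A' - {p}) * P (insert p B)"
      define z where "z = P (A - {a}) * P (insert b B)"
      have u: "P (A - {p}) * P (insert p B) \<preceq> T"
        using nle_trans[OF rel[OF fin p] sum_le] by simp
      have A'B': "A' - B' = A - B"
        using b 4 by (auto simp: A'_def B'_def)
      have v: "P (A' - {p}) * P (insert p B') \<preceq> T"
        using nle_trans[OF rel[OF fin', of p, unfolded A'B', OF p] sum_le] by simp
      have AB': "A - B' = insert a (A - B)" and A'B: "A' - B = insert b (A - B)"
        using b 4 ab by (auto simp: A'_def B'_def)
      \<comment> \<open>Moving \<open>a\<close> from \<open>A\<close> to \<open>B'\<close>, or \<open>b\<close> from \<open>A'\<close> to \<open>B\<close>, gives the same two sets.\<close>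
      have za: "P (A - {a}) * P (insert a B') = z" and zb: "P (A' - {b}) * P (insert b B) = z"
      proof -
        have "insert a B' = insert b B" "A' - {b} = A - {a}"
          using b 4 by (auto simp: A'_def B'_def)
        then show "P (A - {a}) * P (insert a B') = z" "P (A' - {b}) * P (insert b B) = z"
          by (simp_all add: z_def)
      qed
      have pa: "insert a (A - B) - {p} = insert a (A - B - {p})"
        and pb: "insert b (A - B) - {p} = insert b (A - B - {p})"
        using ne[OF p] by auto
      have "x \<preceq> (\<Sum>i \<in> insert a (A - B - {p}). P (A - {i}) * P (insert i B'))"
        unfolding x_def using rel[OF fin(1) fin'(2), of p] p by (simp add: AB' pa)
      also have "\<dots> = z + (\<Sum>i \<in> A - B - {p}. P (A - {i}) * P (insert i B'))"
        using fin 4 by (simp add: za)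
      also have "\<dots> \<preceq> z + T"
        using sum_le[of A B'] by (auto simp: add_nle_iff intro: nle_add_left nle_add_right)
      finally have x: "x \<preceq> z + T" .
      have "y \<preceq> (\<Sum>i \<in> insert b (A - B - {p}). P (A' - {i}) * P (insert i B))"
        unfolding y_def using rel[OF fin'(1) fin(2), of p] p by (simp add: A'B pb)
      also have "\<dots> = z + (\<Sum>i \<in> A - B - {p}. P (A' - {i}) * P (insert i B))"
        using fin b by (simp add: zb)
      also have "\<dots> \<preceq> z + T"
        using sum_le[of A' B] by (auto simp: add_nle_iff intro: nle_add_left nle_add_right)
      finally have y: "y \<preceq> z + T" .
      \<comment> \<open>The same two relations, now with \<open>z\<close> as the distinguished term.\<close>
      have "z \<preceq> (\<Sum>i \<in> A - B. P (A - {i}) * P (insert i B'))"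
        using rel[OF fin(1) fin'(2), of a] 4 by (simp add: AB' za)
      also have "\<dots> = x + (\<Sum>i \<in> A - B - {p}. P (A - {i}) * P (insert i B'))"
        unfolding x_def using fin p by (subst sum.remove[of _ p]) auto
      also have "\<dots> \<preceq> x + T"
        using sum_le[of A B'] by (auto simp: add_nle_iff intro: nle_add_left nle_add_right)
      finally have zx: "z \<preceq> x + T" .
      have "z \<preceq> (\<Sum>i \<in> A - B. P (A' - {i}) * P (insert i B))"
        using rel[OF fin'(1) fin(2), of b] b by (simp add: A'B zb)
      also have "\<dots> = y + (\<Sum>i \<in> A - B - {p}. P (A' - {i}) * P (insert i B))"
        unfolding y_def using fin p by (subst sum.remove[of _ p]) auto
      also have "\<dots> \<preceq> y + T"
        using sum_le[of A' B] by (auto simp: add_nle_iff intro: nle_add_left nle_add_right)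
      finally have zy: "z \<preceq> y + T" .
      have "x \<preceq> y + T" "y \<preceq> x + T"
        using nle_trans[OF x] nle_trans[OF y] zx zy
        by (simp_all add: add_nle_iff nle_add_right)
      \<comment> \<open>The four factors of \<open>x * y\<close> are also those of the \<open>p\<close>-th terms of \<open>(A, B)\<close> and \<open>(A', B')\<close>.\<close>
      moreover have "x * y \<preceq> T * T"
        using mult_nle[OF u v] by (simp add: x_def y_def ac_simps)
      ultimately have "x \<preceq> T" "y \<preceq> T"
        by (auto intro: nle_of_mutual_bounds simp: mult.commute)
      then show ?thesis
        unfolding QQ[OF p] using u v
        by (simp add: algebra_simps add_nle_iff x_def y_def)
    qed
  qed
  then show "?Q (A - {p}) * ?Q (insert p B)
      \<preceq> (\<Sum>i \<in> A - B - {p}. ?Q (A - {i}) * ?Q (insert i B))"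
    by (simp add: T_def)
qed

section \<open>Coefficients of the wedge product\<close>

definition wedge_coeff ::
    "('a set \<Rightarrow> 's::idempotent_semifield) \<Rightarrow> ('a set \<Rightarrow> 's) \<Rightarrow> 'a set \<Rightarrow> 's" where
  "wedge_coeff P P' K = (\<Sum>J \<in> Pow K. P (K - J) * P' J)"

text \<open>
  The direct sum after \<open>Inr m\<close> has been identified with \<open>Inl m\<close> for all \<open>m \<in> M\<close>. In closed form,
  \<open>J\<close> is the set of those identified elements that go to the second factor. It interpolates between
  the direct sum (\<open>M\<close> empty) and the wedge product (\<open>M\<close> the ground set).
\<close>

definition partial_wedge ::
    "'a set \<Rightarrow> ('a set \<Rightarrow> 's::idempotent_semifield) \<Rightarrow> ('a set \<Rightarrow> 's) \<Rightarrow> ('a + 'a) set \<Rightarrow> 's" where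
  "partial_wedge M P P' X =
     (if M \<inter> Inr -` X = {} then
        (\<Sum>J \<in> Pow (M \<inter> Inl -` X). P (Inl -` X - J) * P' (J \<union> Inr -` X)) else 0)"

lemma partial_wedge_empty: "partial_wedge {} P P' = direct_sum P P'"
  by (auto simp: partial_wedge_def direct_sum_def)

lemma partial_wedge_insert:
  fixes P P' :: "'a set \<Rightarrow> 's::idempotent_semifield"
  assumes "finite M" "m \<notin> M"
  shows "partial_wedge (insert m M) P P' = identify (Inl m) (Inr m) (partial_wedge M P P')"
proof
  fix X :: "('a + 'a) set"
  let ?K = "Inl -` X" let ?L = "Inr -` X"
  show "partial_wedge (insert m M) P P' X
      = identify (Inl m) (Inr m) (partial_wedge M P P') X"
  proof (cases "insert m M \<inter> ?L = {} \<and> m \<in> ?K")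
    case True
    let ?N = "M \<inter> ?K"
    have N: "insert m M \<inter> ?K = insert m ?N" "m \<notin> ?N" "finite ?N"
      using True assms by auto
    \<comment> \<open>The two summands of \<open>identify\<close> collect the \<open>J\<close> without and with \<open>m\<close>.\<close>
    have "(\<Sum>J \<in> Pow (insert m ?N). P (?K - J) * P' (J \<union> ?L))
        = (\<Sum>J \<in> Pow ?N. P (?K - J) * P' (J \<union> ?L))
        + (\<Sum>J \<in> insert m ` Pow ?N. P (?K - J) * P' (J \<union> ?L))"
      unfolding Pow_insert using N
      by (intro sum.union_disjoint) (auto simp del: Pow_Int_eq)
    also have "(\<Sum>J \<in> insert m ` Pow ?N. P (?K - J) * P' (J \<union> ?L))
        = (\<Sum>J \<in> Pow ?N. P (?K - {m} - J) * P' (J \<union> insert m ?L))"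
    proof -
      have "inj_on (insert m) (Pow ?N)"
        using N(2) by (auto simp: inj_on_def)
      then show ?thesis
        by (simp add: sum.reindex Diff_insert2[symmetric])
    qed
    moreover have "M \<inter> (?K - {m}) = ?N" using assms by auto
    ultimately show ?thesis
      using True N(1) assms by (auto simp: partial_wedge_def identify_def vimage_Inl_Inr_simps)
  next
    case False
    then show ?thesis
      by (auto simp: partial_wedge_def identify_def)
  qed
qed

lemma pluecker_relations_partial_wedge:
  assumes "finite M" "pluecker_relations P" "pluecker_relations P'"
  shows "pluecker_relations (partial_wedge M P P')"
  using assms(1)
proof (induction M rule: finite_induct)
  case empty
  then show ?case
    using assms by (simp add: partial_wedge_empty pluecker_relations_direct_sum)
next
  case (insert m M)
  then show ?case
    by (simp add: partial_wedge_insert pluecker_relations_identify)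
qed

text \<open>
  Only finitely many elements occur in a relation for \<open>A\<close> and \<open>B\<close>, so it suffices to identify the two
  copies of the elements of \<open>A \<union> B\<close>, on any ground set.
\<close>

lemma pluecker_relations_wedge_coeff:
  fixes P P' :: "'a set \<Rightarrow> 's::idempotent_semifield"
  assumes "pluecker_relations P" "pluecker_relations P'"
  shows "pluecker_relations (wedge_coeff P P')"
  unfolding pluecker_relations_def
proof (intro allI impI)
  fix A B :: "'a set" and p :: 'a
  assume fin: "finite A" "finite B" and p: "p \<in> A - B"
  let ?Q = "partial_wedge (A \<union> B) P P'"
  have Q: "?Q (Inl ` X) = wedge_coeff P P' X" if "X \<subseteq> A \<union> B" for X
  proof -
    have "Inl -` (Inl ` X :: ('a + 'a) set) = X" "Inr -` (Inl ` X :: ('a + 'a) set) = {}" "(A \<union> B) \<inter> X = X"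
      using that by (auto simp: inj_vimage_image_eq)
    then show ?thesis
      by (simp add: partial_wedge_def wedge_coeff_def del: Pow_Int_eq)
  qed
  have Q_A: "?Q (Inl ` A - {Inl i}) = wedge_coeff P P' (A - {i})" for i
    using Q[of "A - {i}"] by (simp add: image_set_diff Diff_subset[THEN subset_trans])
  have Q_B: "?Q (insert (Inl i) (Inl ` B)) = wedge_coeff P P' (insert i B)" if "i \<in> A" for i
    using Q[of "insert i B"] that by simp
  have img: "Inl ` A - Inl ` B - {Inl p} = (Inl ` (A - B - {p}) :: ('a + 'a) set)"
    by auto
  have "?Q (Inl ` A - {Inl p}) * ?Q (insert (Inl p) (Inl ` B))
      \<preceq> (\<Sum>i \<in> Inl ` A - Inl ` B - {Inl p}. ?Q (Inl ` A - {i}) * ?Q (insert i (Inl ` B)))"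
    using fin p assms
    by (intro pluecker_relationsD pluecker_relations_partial_wedge) auto
  also have "\<dots> = (\<Sum>i \<in> A - B - {p}. wedge_coeff P P' (A - {i}) * wedge_coeff P P' (insert i B))"
    unfolding img by (subst sum.reindex) (auto simp: Q_A Q_B)
  finally show "wedge_coeff P P' (A - {p}) * wedge_coeff P P' (insert p B)
      \<preceq> (\<Sum>i \<in> A - B - {p}. wedge_coeff P P' (A - {i}) * wedge_coeff P P' (insert i B))"
    using p by (simp add: Q_A Q_B)
qed

section \<open>Tropical Pluecker vectors in the Grassmann algebra\<close>

definition extend_by_zero ::
    "nat \<Rightarrow> nat \<Rightarrow> (nat set \<Rightarrow> 's) \<Rightarrow> nat set \<Rightarrow> 's::idempotent_semifield" where
  "extend_by_zero n d c I = (if I \<in> subsets_of_size n d then c I else 0)"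

lemma basis_expansion_extend_by_zero:
  "basis_expansion n d (extend_by_zero n d c) = basis_expansion n d c"
  by (simp add: basis_expansion_def extend_by_zero_def cong: sum.cong)

lemma tropical_pluecker_vectorE:
  assumes "tropical_pluecker_vector n d w"
  obtains c where "w = basis_expansion n d c" "pluecker_relations c"
    "\<And>I. I \<notin> subsets_of_size n d \<Longrightarrow> c I = 0"
proof -
  obtain c where w: "w = basis_expansion n d c" and
    c: "\<And>A B p. \<lbrakk>A \<subseteq> {1..n}; card A = d + 1; B \<subseteq> {1..n}; card B + 1 = d; p \<in> A - B\<rbrakk> \<Longrightarrow>
            (\<Sum>i \<in> A - B. c (A - {i}) * c (insert i B)) =
            (\<Sum>i \<in> A - B - {p}. c (A - {i}) * c (insert i B))"
    using assms unfolding tropical_pluecker_vector_def by blast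
  let ?c = "extend_by_zero n d c"
  have "pluecker_relations ?c"
    unfolding pluecker_relations_def
  proof (intro allI impI)
    fix A B :: "nat set" and p :: nat
    assume fin: "finite A" "finite B" and p: "p \<in> A - B"
    show "?c (A - {p}) * ?c (insert p B) \<preceq> (\<Sum>i \<in> A - B - {p}. ?c (A - {i}) * ?c (insert i B))"
    proof (cases "A - {p} \<in> subsets_of_size n d \<and> insert p B \<in> subsets_of_size n d")
      case False
      then show ?thesis by (auto simp: extend_by_zero_def)
    next
      case True
      then have sz: "A \<subseteq> {1..n}" "card A = d + 1" "B \<subseteq> {1..n}" "card B + 1 = d"
        using fin p by (auto simp: subsets_of_size_def card_Diff_singleton card_gt_0_iff)
      then have eq: "?c (A - {i}) * ?c (insert i B) = c (A - {i}) * c (insert i B)"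
        if "i \<in> A - B" for i
        using that fin by (auto simp: extend_by_zero_def subsets_of_size_def)
      have "c (A - {p}) * c (insert p B) \<preceq> (\<Sum>i \<in> A - B - {p}. c (A - {i}) * c (insert i B))"
        using c[OF sz p] fin p by (subst (asm) sum_eq_sum_remove_iff) auto
      then show ?thesis
        using p by (simp add: eq)
    qed
  qed
  then show thesis
    by (intro that[of ?c]) (auto simp: w basis_expansion_extend_by_zero extend_by_zero_def)
qed

lemma squarefree_exponent_Un_disjoint:
  assumes "finite I" "finite J" "I \<inter> J = {}"
  shows "squarefree_exponent (I \<union> J) = squarefree_exponent I + squarefree_exponent J"
  using assms by (simp add: squarefree_exponent_def sum.union_disjoint)

text \<open>
  In the product of two basis expansions, the monomials of overlapping \<open>I\<close> and \<open>J\<close> contain a square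
  and are congruent to zero; the others are grouped by \<open>K = I \<union> J\<close>. As the coefficients vanish off
  the subsets of the right size, \<open>J\<close> may range over all subsets of \<open>K\<close>.
\<close>

lemma wedge_basis_expansion:
  fixes c c' :: "nat set \<Rightarrow> 's::idempotent_semifield"
  assumes c: "\<And>I. I \<notin> subsets_of_size n d \<Longrightarrow> c I = 0"
    and c': "\<And>J. J \<notin> subsets_of_size n d' \<Longrightarrow> c' J = 0"
  shows "wedge n (basis_expansion n d c) (basis_expansion n d' c')
    = basis_expansion n (d + d') (wedge_coeff c c')"
proof -
  let ?S = "subsets_of_size n d" and ?S' = "subsets_of_size n d'"
    and ?T = "subsets_of_size n (d + d')"
  define p where "p = (\<Sum>I \<in> ?S. Const (c I) * (\<Prod>i \<in> I. Var i))"
  define q where "q = (\<Sum>J \<in> ?S'. Const (c' J) * (\<Prod>i \<in> J. Var i))"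
  let ?mon = "\<lambda>I J. Poly_Mapping.single (squarefree_exponent (I \<union> J)) (c I * c' J)"
  have "p * q = (\<Sum>(I, J) \<in> ?S \<times> ?S'.
      Poly_Mapping.single (squarefree_exponent I + squarefree_exponent J) (c I * c' J))"
    by (simp add: p_def q_def basis_monomial sum_product sum.cartesian_product mult_single)
  moreover have "grassmann_cong n \<dots> (\<Sum>(I, J) \<in> ?S \<times> ?S'. if I \<inter> J = {} then ?mon I J else 0)"
  proof (rule grassmann_cong_sum, clarify)
    fix I J assume IJ: "I \<in> ?S" "J \<in> ?S'"
    then have fin: "finite I" "finite J"
      by (auto intro: finite_in_subsets_of_size)
    have sub: "Poly_Mapping.keys (squarefree_exponent I + squarefree_exponent J) \<subseteq> {1..n}"
      using keys_add[of "squarefree_exponent I" "squarefree_exponent J"] IJ fin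
      by (auto simp: keys_squarefree_exponent subsets_of_size_def)
    show "grassmann_cong n
        (Poly_Mapping.single (squarefree_exponent I + squarefree_exponent J) (c I * c' J))
        (if I \<inter> J = {} then ?mon I J else 0)"
    proof (cases "I \<inter> J = {}")
      case True
      then show ?thesis
        using grassmann_cong.refl[OF Sym_single[OF sub]] fin
        by (simp add: squarefree_exponent_Un_disjoint)
    next
      case False
      then obtain i where "i \<in> I" "i \<in> J" by blast
      then have "Poly_Mapping.lookup (squarefree_exponent I + squarefree_exponent J) i > 1"
        using fin by (simp add: lookup_add lookup_squarefree_exponent)
      then show ?thesis
        using False grassmann_cong_nonsquarefree[OF sub] by simp
    qed
  qed
  moreover have "(\<Sum>(I, J) \<in> ?S \<times> ?S'. if I \<inter> J = {} then ?mon I J else 0)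
      = (\<Sum>(I, J) \<in> {(I, J) \<in> ?S \<times> ?S'. I \<inter> J = {}}. ?mon I J)"
    by (rule sum.mono_neutral_cong_right) (auto split: if_splits)
  moreover have "\<dots> = (\<Sum>(K, J) \<in> {(K, J) \<in> Sigma ?T Pow. K - J \<in> ?S \<and> J \<in> ?S'}. ?mon (K - J) J)"
  proof (rule sum.reindex_bij_witness[of _ "\<lambda>(K, J). (K - J, J)" "\<lambda>(I, J). (I \<union> J, J)"], goal_cases)
    case (2 x)
    then obtain I J where x: "x = (I, J)" "I \<in> ?S" "J \<in> ?S'" "I \<inter> J = {}"
      by blast
    then have "finite I" "finite J"
      by (auto intro: finite_in_subsets_of_size)
    then have "I \<union> J \<in> ?T"
      using x by (simp add: subsets_of_size_def card_Un_disjoint)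
    moreover have "I \<union> J - J = I"
      using x by auto
    ultimately show ?case
      using x by simp
  next
    case (5 x)
    then obtain I J where x: "x = (I, J)" "I \<inter> J = {}"
      by blast
    then have "I \<union> J - J = I"
      by auto
    then show ?case
      using x by simp
  qed auto
  moreover have "\<dots> = (\<Sum>(K, J) \<in> Sigma ?T Pow. ?mon (K - J) J)"
  proof (rule sum.mono_neutral_left)
    have zero: "?mon (K - J) J = 0" if "K - J \<notin> ?S \<or> J \<notin> ?S'" for K J
      using that c c' by auto
    show "\<forall>x \<in> Sigma ?T Pow - {(K, J) \<in> Sigma ?T Pow. K - J \<in> ?S \<and> J \<in> ?S'}.
        (case x of (K, J) \<Rightarrow> ?mon (K - J) J) = 0"
    proof
      fix x
      assume x: "x \<in> Sigma ?T Pow - {(K, J) \<in> Sigma ?T Pow. K - J \<in> ?S \<and> J \<in> ?S'}"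
      obtain K J where KJ: "x = (K, J)"
        by force
      then have "K - J \<notin> ?S \<or> J \<notin> ?S'"
        using x by blast
      then show "(case x of (K, J) \<Rightarrow> ?mon (K - J) J) = 0"
        using zero KJ by simp
    qed
  qed (auto simp: finite_in_subsets_of_size)
  moreover have "\<dots> = (\<Sum>K \<in> ?T. Const (wedge_coeff c c' K) * (\<Prod>i \<in> K. Var i))"
  proof -
    have "Poly_Mapping.single m (wedge_coeff c c' K)
        = (\<Sum>J \<in> Pow K. Poly_Mapping.single m (c (K - J) * c' J))" for K and m :: "nat \<Rightarrow>\<^sub>0 nat"
      unfolding wedge_coeff_def
      by (rule poly_mapping_eqI) (simp add: lookup_single lookup_sum when_def)
    moreover have "(\<Sum>(K, J) \<in> Sigma ?T Pow. ?mon (K - J) J)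
        = (\<Sum>K \<in> ?T. \<Sum>J \<in> Pow K. ?mon (K - J) J)"
      by (rule sum.Sigma[symmetric]) (auto simp: finite_in_subsets_of_size)
    moreover have "K - J \<union> J = K" if "J \<in> Pow K" for J K :: "nat set"
      using that by auto
    ultimately show ?thesis
      by (simp add: basis_monomial)
  qed
  ultimately have "grassmann_cong n (p * q)
      (\<Sum>K \<in> ?T. Const (wedge_coeff c c' K) * (\<Prod>i \<in> K. Var i))"
    by simp
  moreover have "p \<in> Sym n" "q \<in> Sym n"
    unfolding p_def q_def by (rule basis_sum_Sym)+
  moreover have "wedge n (basis_expansion n d c) (basis_expansion n d' c')
      = grassmann_class n (p * q)"
    unfolding basis_expansion_def p_def q_def by (intro wedge_grassmann_class basis_sum_Sym)
  ultimately show ?thesis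
    by (simp add: grassmann_class_eq_iff Sym_mult basis_sum_Sym basis_expansion_def)
qed

theorem proposition5p1p2:
  fixes n d d' :: nat
    and w w' :: "'s::idempotent_semifield polynomial set"
  assumes "tropical_pluecker_vector n d w"
    and "tropical_pluecker_vector n d' w'"
    and "wedge n w w' \<noteq> grassmann_class n 0"
  shows "tropical_pluecker_vector n (d + d') (wedge n w w')"
proof -
  obtain c where w: "w = basis_expansion n d c" and c: "pluecker_relations c"
    and c0: "\<And>I. I \<notin> subsets_of_size n d \<Longrightarrow> c I = 0"
    using tropical_pluecker_vectorE[OF assms(1)] by metis
  obtain c' where w': "w' = basis_expansion n d' c'" and c': "pluecker_relations c'"
    and c'0: "\<And>I. I \<notin> subsets_of_size n d' \<Longrightarrow> c' I = 0"
    using tropical_pluecker_vectorE[OF assms(2)] by metis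
  let ?u = "wedge_coeff c c'"
  have u: "wedge n w w' = basis_expansion n (d + d') ?u"
    unfolding w w' using c0 c'0 by (rule wedge_basis_expansion)
  have "(\<Sum>i \<in> A - B. ?u (A - {i}) * ?u (insert i B))
      = (\<Sum>i \<in> A - B - {p}. ?u (A - {i}) * ?u (insert i B))"
    if "A \<subseteq> {1..n}" "B \<subseteq> {1..n}" "p \<in> A - B" for A B p
  proof -
    have "finite A" "finite B"
      using that by (auto intro: finite_subset)
    then show ?thesis
      using pluecker_relationsD[OF pluecker_relations_wedge_coeff[OF c c'], of A B p] that(3)
      by (simp only: sum_eq_sum_remove_iff finite_Diff)
  qed
  moreover have "wedge n w w' \<in> exterior_power n (d + d')"
    by (simp add: u exterior_power_eq)
  ultimately show ?thesis
    unfolding tropical_pluecker_vector_def using assms(3)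
    by (intro conjI exI[of _ ?u] u) blast+
qed

end
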